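(* Let $\hat{\mathbf{x}}\in\mathbb{R}^n$, $P\in\mathbb{R}^{n\times n}$ and $R\in\mathbb{R}^{m\times m}$ symmetric positive definite, $H\in\mathbb{R}^{m\times n}$, $\mathbf{z}\in\mathbb{R}^m$. Assume the prior is $p(\mathbf{x})=p_{\mathcal{N}}(\mathbf{x};\hat{\mathbf{x}},P)$ and the likelihood is $p(\mathbf{z}|\mathbf{x})=p_{\mathcal{N}}(\mathbf{z};H\mathbf{x},R)$. Let $$\boldsymbol{\mu}_p=\hat{\mathbf{x}}+PH^{\top}(R+HPH^{\top})^{-1}(\mathbf{z}-H\hat{\mathbf{x}}),\qquad \Sigma_p^{-1}=P^{-1}+H^{\top}R^{-1}H$$ be the posterior mean and inverse posterior covariance. Let $(\boldsymbol{\mu}_t,\Sigma_t)$, $t\ge0$, solve the Gaussian Fisher-Rao parameter flow $$\frac{d\boldsymbol{\mu}_t}{dt}=-\Sigma_t\Sigma_p^{-1}(\boldsymbol{\mu}_t-\boldsymbol{\mu}_p),\qquad \frac{d\Sigma_t^{-1}}{dt}=\Sigma_p^{-1}-\Sigma_t^{-1},\qquad \boldsymbol{\mu}_0=\hat{\mathbf{x}},\ \Sigma_0=P,$$ and let the Gaussian Fisher-Rao particle dynamics function be $\tilde{\phi}(\mathbf{x},t)=\tilde A_t\mathbf{x}+\tilde{\mathbf{b}}_t$ with $$\tilde A_t=-\tfrac12\Sigma_t(\Sigma_p^{-1}-\Sigma_t^{-1}),\qquad \tilde{\mathbf{b}}_t=\Sigma_t\Sigma_p^{-1}(\boldsymbol{\mu}_p-\boldsymbol{\mu}_t)-\tilde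 A_t\boldsymbol{\mu}_t.$$ Let the Exact Daum and Huang (EDH) particle dynamics function be $\phi(\mathbf{x},\lambda)=A_\lambda\mathbf{x}+\mathbf{b}_\lambda$, $\lambda\in[0,1]$, with $$A_\lambda=-\tfrac12PH^{\top}(R+\lambda HPH^{\top})^{-1}H,\qquad \mathbf{b}_\lambda=(I+2\lambda A_\lambda)\big(A_\lambda\hat{\mathbf{x}}+(I+\lambda A_\lambda)PH^{\top}R^{-1}\mathbf{z}\big).$$ Then $\tilde\phi$ is a time-scaled version of $\phi$ with time scaling function $\lambda(t)=1-\exp(-t)$; that is, for all $t\ge0$ and $\mathbf{x}\in\mathbb{R}^n$, $$\tilde\phi(\mathbf{x},t)=\frac{d\lambda(t)}{dt}\,\phi(\mathbf{x},\lambda(t))=(1-\lambda(t))\,\phi(\mathbf{x},\lambda(t)).$$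
   Context: $p_{\mathcal{N}}(\cdot;\boldsymbol{\mu},\Sigma)$ denotes the Gaussian probability density with mean $\boldsymbol{\mu}$ and covariance $\Sigma$. A particle dynamics function $\phi$ governs particles through $d\mathbf{x}_t/dt=\phi(\mathbf{x}_t,t)$. *)

theory Defs
  imports "HOL-Analysis.Analysis"
begin

definition sym_pos_def :: "real^'n^'n \<Rightarrow> bool" where
  "sym_pos_def M \<longleftrightarrow> transpose M = M \<and> (\<forall>v. v \<noteq> 0 \<longrightarrow> v \<bullet> (M *v v) > 0)"

definition gaussian_density :: "real^'n \<Rightarrow> real^'n^'n \<Rightarrow> real^'n \<Rightarrow> real" where
  "gaussian_density \<mu> \<Sigma> x =
     exp (- (1/2) * ((x - \<mu>) \<bullet> (matrix_inv \<Sigma> *v (x - \<mu>))))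
       / sqrt ((2 * pi) ^ CARD('n) * det \<Sigma>)"

text \<open>Throughout, \<open>H\<close> has \<open>CARD('m)\<close> rows and \<open>CARD('n)\<close> columns.\<close>

definition posterior_mean ::
    "real^'n \<Rightarrow> real^'n^'n \<Rightarrow> real^'n^'m \<Rightarrow> real^'m^'m \<Rightarrow> real^'m \<Rightarrow> real^'n" where
  "posterior_mean xhat P H R z =
     xhat + (P ** transpose H ** matrix_inv (R + H ** P ** transpose H)) *v (z - H *v xhat)"

definition posterior_precision ::
    "real^'n^'n \<Rightarrow> real^'n^'m \<Rightarrow> real^'m^'m \<Rightarrow> real^'n^'n" where
  "posterior_precision P H R = matrix_inv P + transpose H ** matrix_inv R ** H"

text \<open>
  Invertibility of \<open>\<Sigma> t\<close> is stated explicitly because \<^const>\<open>matrix_inv\<close> is an arbitrary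
  matrix on singular arguments. The derivatives are one-sided at time 0; values at negative
  times are irrelevant.
\<close>

definition gaussian_fisher_rao_flow ::
    "real^'n \<Rightarrow> real^'n^'n \<Rightarrow> real^'n \<Rightarrow> real^'n^'n
      \<Rightarrow> (real \<Rightarrow> real^'n) \<Rightarrow> (real \<Rightarrow> real^'n^'n) \<Rightarrow> bool" where
  "gaussian_fisher_rao_flow \<mu>\<^sub>p \<Sigma>\<^sub>p \<mu>\<^sub>0 \<Sigma>\<^sub>0 \<mu> \<Sigma> \<longleftrightarrow>
     \<mu> 0 = \<mu>\<^sub>0 \<and> \<Sigma> 0 = \<Sigma>\<^sub>0 \<and>
     (\<forall>t\<ge>0. invertible (\<Sigma> t) \<and>
        (\<mu> has_vector_derivative - ((\<Sigma> t ** matrix_inv \<Sigma>\<^sub>p) *v (\<mu> t - \<mu>\<^sub>p))) (at t within {0..}) \<and>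
        ((\<lambda>s. matrix_inv (\<Sigma> s)) has_vector_derivative matrix_inv \<Sigma>\<^sub>p - matrix_inv (\<Sigma> t))
          (at t within {0..}))"

definition fisher_rao_A :: "real^'n^'n \<Rightarrow> (real \<Rightarrow> real^'n^'n) \<Rightarrow> real \<Rightarrow> real^'n^'n" where
  "fisher_rao_A \<Sigma>\<^sub>p \<Sigma> t = (- (1/2)) *\<^sub>R (\<Sigma> t ** (matrix_inv \<Sigma>\<^sub>p - matrix_inv (\<Sigma> t)))"

definition fisher_rao_b ::
    "real^'n \<Rightarrow> real^'n^'n \<Rightarrow> (real \<Rightarrow> real^'n) \<Rightarrow> (real \<Rightarrow> real^'n^'n) \<Rightarrow> real \<Rightarrow> real^'n" where
  "fisher_rao_b \<mu>\<^sub>p \<Sigma>\<^sub>p \<mu> \<Sigma> t =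
     (\<Sigma> t ** matrix_inv \<Sigma>\<^sub>p) *v (\<mu>\<^sub>p - \<mu> t) - fisher_rao_A \<Sigma>\<^sub>p \<Sigma> t *v \<mu> t"

definition fisher_rao_dynamics ::
    "real^'n \<Rightarrow> real^'n^'n \<Rightarrow> (real \<Rightarrow> real^'n) \<Rightarrow> (real \<Rightarrow> real^'n^'n)
      \<Rightarrow> real^'n \<Rightarrow> real \<Rightarrow> real^'n" where
  "fisher_rao_dynamics \<mu>\<^sub>p \<Sigma>\<^sub>p \<mu> \<Sigma> x t = fisher_rao_A \<Sigma>\<^sub>p \<Sigma> t *v x + fisher_rao_b \<mu>\<^sub>p \<Sigma>\<^sub>p \<mu> \<Sigma> t"

text \<open>The formulas below are meaningful for pseudo-time \<open>l \<in> {0..1}\<close>.\<close>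

definition edh_A ::
    "real^'n^'n \<Rightarrow> real^'n^'m \<Rightarrow> real^'m^'m \<Rightarrow> real \<Rightarrow> real^'n^'n" where
  "edh_A P H R l =
     (- (1/2)) *\<^sub>R (P ** transpose H ** matrix_inv (R + l *\<^sub>R (H ** P ** transpose H)) ** H)"

definition edh_b ::
    "real^'n \<Rightarrow> real^'n^'n \<Rightarrow> real^'n^'m \<Rightarrow> real^'m^'m \<Rightarrow> real^'m \<Rightarrow> real \<Rightarrow> real^'n" where
  "edh_b xhat P H R z l =
     (mat 1 + (2 * l) *\<^sub>R edh_A P H R l) *v
       (edh_A P H R l *v xhat
        + ((mat 1 + l *\<^sub>R edh_A P H R l) ** P ** transpose H ** matrix_inv R) *v z)"

definition edh_dynamics ::
    "real^'n \<Rightarrow> real^'n^'n \<Rightarrow> real^'n^'m \<Rightarrow> real^'m^'m \<Rightarrow> real^'m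
      \<Rightarrow> real^'n \<Rightarrow> real \<Rightarrow> real^'n" where
  "edh_dynamics xhat P H R z x l = edh_A P H R l *v x + edh_b xhat P H R z l"

definition time_scaling :: "real \<Rightarrow> real" where
  "time_scaling t = 1 - exp (- t)"

end

theory Submission
  imports Defs
begin

text \<open>
  Write \<open>N t\<close> for the inverse of \<open>\<Sigma> t\<close>, \<open>G\<close> for \<open>H\<^sup>T R\<^sup>-\<^sup>1 H\<close> and \<open>l\<close> for \<open>1 - exp (- t)\<close>. Both
  \<open>N - \<Sigma>\<^sub>p\<^sup>-\<^sup>1\<close> and \<open>N (\<mu> - \<mu>\<^sub>p)\<close> solve \<open>y' = - y\<close>, so the flow is explicit:
  \<open>N t = P\<^sup>-\<^sup>1 + l G\<close> and \<open>N t \<mu>\<^sub>t = P\<^sup>-\<^sup>1 xhat + l H\<^sup>T R\<^sup>-\<^sup>1 z\<close>. By the Kalman gain identity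
  \<open>P H\<^sup>T (R + l H P H\<^sup>T)\<^sup>-\<^sup>1 = \<Sigma>\<^sub>t H\<^sup>T R\<^sup>-\<^sup>1\<close> the EDH matrix is \<open>- (1/2) \<Sigma>\<^sub>t G\<close>, and \<open>I + 2 l A\<^sub>l\<close>
  equals \<open>\<Sigma>\<^sub>t P\<^sup>-\<^sup>1\<close>, whence both dynamics reduce to the same expression up to the factor \<open>exp (- t)\<close>.
\<close>

lemma matrix_inv_right_left:
  fixes A :: "real^'n^'n"
  assumes "invertible A"
  shows matrix_inv_right: "A ** matrix_inv A = mat 1"
    and matrix_inv_left: "matrix_inv A ** A = mat 1"
proof -
  have "A ** matrix_inv A = mat 1 \<and> matrix_inv A ** A = mat 1"
    using assms unfolding invertible_def matrix_inv_def by (rule someI_ex)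
  then show "A ** matrix_inv A = mat 1" "matrix_inv A ** A = mat 1" by auto
qed

lemma matrix_inv_mult_vec:
  fixes A :: "real^'n^'n"
  assumes "invertible A"
  shows "A *v (matrix_inv A *v v) = v" and "matrix_inv A *v (A *v v) = v"
  using assms by (simp_all add: matrix_vector_mul_assoc matrix_inv_right matrix_inv_left)

lemma invertible_if_pos_def:
  fixes A :: "real^'n^'n"
  assumes "\<And>v. v \<noteq> 0 \<Longrightarrow> v \<bullet> (A *v v) > 0"
  shows "invertible A"
proof -
  have "v = 0" if "A *v v = 0" for v
    using assms[of v] that by force
  then show ?thesis
    by (simp add: invertible_left_inverse matrix_left_invertible_ker)
qed

lemma sym_pos_def_invertible: "sym_pos_def A \<Longrightarrow> invertible A"
  by (simp add: sym_pos_def_def invertible_if_pos_def)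

text \<open>Moving \<open>H\<close> across the inner product turns the second summand into the
  quadratic form of \<open>P\<close> at \<open>transpose H *v v\<close>, which is nonnegative;
  \<open>R\<close> makes the sum strictly positive.\<close>

lemma innovation_covariance_invertible:
  fixes P :: "real^'n^'n" and R :: "real^'m^'m" and H :: "real^'n^'m"
  assumes "sym_pos_def P" and "sym_pos_def R" and "l \<ge> 0"
  shows "invertible (R + l *\<^sub>R (H ** P ** transpose H))"
proof (rule invertible_if_pos_def)
  fix v :: "real^'m" assume "v \<noteq> 0"
  let ?w = "transpose H *v v"
  have "v \<bullet> ((H ** P ** transpose H) *v v) = ?w \<bullet> (P *v ?w)"
    by (simp add: dot_lmul_matrix flip: matrix_vector_mul_assoc)
  moreover have "?w \<bullet> (P *v ?w) \<ge> 0"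
    using assms(1) unfolding sym_pos_def_def by (cases "?w = 0") (auto intro: less_imp_le)
  moreover have "v \<bullet> (R *v v) > 0"
    using assms(2) \<open>v \<noteq> 0\<close> by (simp add: sym_pos_def_def)
  ultimately show "v \<bullet> ((R + l *\<^sub>R (H ** P ** transpose H)) *v v) > 0"
    using \<open>l \<ge> 0\<close>
    by (simp add: matrix_vector_mult_add_rdistrib inner_add_right add_pos_nonneg
        flip: scaleR_matrix_vector_assoc)
qed

text \<open>With \<open>S = R + l H P H^T\<close> and \<open>w = S^-1 v\<close>, substituting
  \<open>v = S w\<close> turns both sides into \<open>H^T w + l H^T R^-1 H P H^T w\<close>. Used at
  \<open>l = 1\<close> for the posterior mean and at the pseudo-time for the EDH matrix.\<close>

lemma kalman_gain_identity:
  fixes P :: "real^'n^'n" and R :: "real^'m^'m" and H :: "real^'n^'m"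
  assumes "invertible P" and "invertible R"
    and "invertible (R + l *\<^sub>R (H ** P ** transpose H))"
  shows "(matrix_inv P + l *\<^sub>R (transpose H ** matrix_inv R ** H)) *v
      (P *v (transpose H *v (matrix_inv (R + l *\<^sub>R (H ** P ** transpose H)) *v v)))
    = transpose H *v (matrix_inv R *v v)"
proof -
  define T where "T = transpose H"
  define S where "S = R + l *\<^sub>R (H ** P ** T)"
  define w where "w = matrix_inv S *v v"
  have "v = S *v w"
    using assms(3) by (simp add: w_def S_def T_def matrix_inv_mult_vec)
  then have v: "v = R *v w + l *\<^sub>R (H *v (P *v (T *v w)))"
    by (simp add: S_def matrix_vector_mult_add_rdistrib
        flip: scaleR_matrix_vector_assoc matrix_vector_mul_assoc)
  have "(matrix_inv P + l *\<^sub>R (T ** matrix_inv R ** H)) *v (P *v (T *v w))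
      = T *v (matrix_inv R *v v)"
    \<comment> \<open>The \<open>v\<close> inside \<open>w\<close> is hidden by the local
      definition, so only the right-hand side is expanded.\<close>
    unfolding v using assms(1,2)
    by (simp add: algebra_simps matrix_inv_mult_vec
        flip: scaleR_matrix_vector_assoc matrix_vector_mul_assoc)
  then show ?thesis
    by (simp only: w_def S_def T_def)
qed

text \<open>Supplies the product rule for a time-dependent matrix applied to a time-dependent
  vector.\<close>

lemma bounded_bilinear_matrix_vector_mult:
  "bounded_bilinear ((*v) :: real^'n^'m \<Rightarrow> real^'n \<Rightarrow> real^'m)"
  unfolding bilinear_conv_bounded_bilinear[symmetric] bilinear_def
  by (auto intro!: linearI simp: algebra_simps simp flip: scaleR_matrix_vector_assoc)

text \<open>Integrating factor: \<open>exp s *\<^sub>R y s\<close> has zero derivative on the convex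
  set \<open>{0..}\<close>, hence is constant. The general normed space covers both the matrix and
  the vector quantity of the flow.\<close>

lemma exponential_decay_unique:
  fixes y :: "real \<Rightarrow> 'a::real_normed_vector"
  assumes "\<And>t. t \<ge> 0 \<Longrightarrow> (y has_vector_derivative - y t) (at t within {0..})"
    and "t \<ge> 0"
  shows "y t = exp (- t) *\<^sub>R y 0"
proof -
  have "((\<lambda>s. exp s *\<^sub>R y s) has_derivative (\<lambda>h. 0)) (at s within {0..})" if "s \<in> {0..}" for s
  proof -
    have "((\<lambda>s. exp s *\<^sub>R y s) has_vector_derivative exp s *\<^sub>R (- y s) + exp s *\<^sub>R y s)
        (at s within {0..})"
      using that by (intro has_vector_derivative_scaleR assms DERIV_exp[THEN DERIV_subset]) auto
    then show ?thesis by (simp add: has_vector_derivative_def)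
  qed
  then have "\<exists>c. \<forall>s\<in>{0..}. exp s *\<^sub>R y s = c"
    by (intro has_derivative_zero_constant) auto
  with \<open>t \<ge> 0\<close> have "exp t *\<^sub>R y t = exp 0 *\<^sub>R y 0"
    by (metis atLeast_iff order_refl)
  then have "exp (- t) *\<^sub>R (exp t *\<^sub>R y t) = exp (- t) *\<^sub>R y 0"
    by simp
  then show ?thesis
    by (simp add: exp_minus)
qed

lemma fisher_rao_flow_precision:
  assumes "gaussian_fisher_rao_flow \<mu>\<^sub>p \<Sigma>\<^sub>p \<mu>\<^sub>0 \<Sigma>\<^sub>0 \<mu> \<Sigma>" and "t \<ge> 0"
  shows "matrix_inv (\<Sigma> t)
    = matrix_inv \<Sigma>\<^sub>p + exp (- t) *\<^sub>R (matrix_inv \<Sigma>\<^sub>0 - matrix_inv \<Sigma>\<^sub>p)"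
proof -
  have "matrix_inv (\<Sigma> t) - matrix_inv \<Sigma>\<^sub>p
      = exp (- t) *\<^sub>R (matrix_inv (\<Sigma> 0) - matrix_inv \<Sigma>\<^sub>p)"
  proof (rule exponential_decay_unique[OF _ \<open>t \<ge> 0\<close>])
    fix s :: real assume "s \<ge> 0"
    then have "((\<lambda>s. matrix_inv (\<Sigma> s)) has_vector_derivative matrix_inv \<Sigma>\<^sub>p - matrix_inv (\<Sigma> s))
        (at s within {0..})"
      using assms(1) by (simp add: gaussian_fisher_rao_flow_def)
    then show "((\<lambda>s. matrix_inv (\<Sigma> s) - matrix_inv \<Sigma>\<^sub>p)
        has_vector_derivative - (matrix_inv (\<Sigma> s) - matrix_inv \<Sigma>\<^sub>p)) (at s within {0..})"
      by (auto intro!: derivative_eq_intros)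
  qed
  moreover have "\<Sigma> 0 = \<Sigma>\<^sub>0"
    using assms(1) by (simp add: gaussian_fisher_rao_flow_def)
  ultimately show ?thesis
    by (simp add: algebra_simps)
qed

text \<open>Multiplying by the precision removes \<open>\<Sigma> t\<close> from the mean equation:
  in the product rule, \<open>N (- \<Sigma> Q d) = - Q d\<close> cancels the \<open>Q d\<close>
  coming from \<open>N' = Q - N\<close>, and \<open>- N d\<close> remains.\<close>

lemma fisher_rao_flow_mean:
  assumes flow: "gaussian_fisher_rao_flow \<mu>\<^sub>p \<Sigma>\<^sub>p \<mu>\<^sub>0 \<Sigma>\<^sub>0 \<mu> \<Sigma>" and "t \<ge> 0"
  shows "matrix_inv (\<Sigma> t) *v (\<mu> t - \<mu>\<^sub>p) = exp (- t) *\<^sub>R (matrix_inv \<Sigma>\<^sub>0 *v (\<mu>\<^sub>0 - \<mu>\<^sub>p))"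
proof -
  have "matrix_inv (\<Sigma> t) *v (\<mu> t - \<mu>\<^sub>p) = exp (- t) *\<^sub>R (matrix_inv (\<Sigma> 0) *v (\<mu> 0 - \<mu>\<^sub>p))"
  proof (rule exponential_decay_unique[OF _ \<open>t \<ge> 0\<close>])
    fix s :: real assume "s \<ge> 0"
    let ?Q = "matrix_inv \<Sigma>\<^sub>p" and ?N = "\<lambda>s. matrix_inv (\<Sigma> s)" and ?d = "\<lambda>s. \<mu> s - \<mu>\<^sub>p"
    have inv: "invertible (\<Sigma> s)"
      and N': "(?N has_vector_derivative ?Q - ?N s) (at s within {0..})"
      and d': "(?d has_vector_derivative - (\<Sigma> s *v (?Q *v ?d s))) (at s within {0..})"
      using flow \<open>s \<ge> 0\<close>
      by (auto simp: gaussian_fisher_rao_flow_def matrix_vector_mul_assoc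
          intro!: derivative_eq_intros)
    have "?N s *v - (\<Sigma> s *v (?Q *v ?d s)) + (?Q - ?N s) *v ?d s = - (?N s *v ?d s)"
      using matrix_inv_mult_vec(2)[OF inv, of "- (?Q *v ?d s)"]
        linear_neg[OF matrix_vector_mul_linear, of "\<Sigma> s" "?Q *v ?d s"]
      by (simp add: matrix_vector_mult_diff_rdistrib)
    with bounded_bilinear.has_vector_derivative[OF bounded_bilinear_matrix_vector_mult N' d']
    show "((\<lambda>s. ?N s *v ?d s) has_vector_derivative - (?N s *v ?d s)) (at s within {0..})"
      by simp
  qed
  with flow show ?thesis
    by (simp add: gaussian_fisher_rao_flow_def)
qed

text \<open>Information form of the Bayesian update: the gain identity at \<open>l = 1\<close>
  removes the inverse innovation covariance.\<close>

lemma posterior_mean_eq: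
  fixes P :: "real^'n^'n" and R :: "real^'m^'m" and H :: "real^'n^'m"
  assumes "sym_pos_def P" and "sym_pos_def R"
  shows "posterior_precision P H R *v posterior_mean xhat P H R z
    = matrix_inv P *v xhat + transpose H *v (matrix_inv R *v z)"
proof -
  define T where "T = transpose H"
  define K where "K = P *v (T *v (matrix_inv (R + H ** P ** T) *v (z - H *v xhat)))"
  have inv: "invertible P" "invertible R" "invertible (R + 1 *\<^sub>R (H ** P ** transpose H))"
    using assms sym_pos_def_invertible innovation_covariance_invertible[of P R 1 H] by auto
  have K: "posterior_precision P H R *v K = T *v (matrix_inv R *v (z - H *v xhat))"
    using kalman_gain_identity[OF inv] unfolding posterior_precision_def K_def T_def
    by (simp del: transpose_matrix_vector)
  have "posterior_mean xhat P H R z = xhat + K"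
    by (simp add: posterior_mean_def K_def T_def matrix_vector_mul_assoc matrix_mul_assoc
        del: transpose_matrix_vector)
  then have "posterior_precision P H R *v posterior_mean xhat P H R z
      = posterior_precision P H R *v xhat + T *v (matrix_inv R *v (z - H *v xhat))"
    by (simp add: K matrix_vector_right_distrib)
  \<comment> \<open>The term \<open>H^T R^-1 H xhat\<close> of the posterior precision cancels
    against the innovation.\<close>
  also have "\<dots> = matrix_inv P *v xhat + T *v (matrix_inv R *v z)"
    by (simp add: posterior_precision_def algebra_simps
        flip: T_def matrix_vector_mul_assoc)
  finally show ?thesis
    by (simp only: T_def)
qed

theorem theorem5:
  fixes xhat \<mu>\<^sub>p :: "real^'n" and P \<Sigma>\<^sub>p :: "real^'n^'n" and R :: "real^'m^'m"
    and H :: "real^'n^'m" and z :: "real^'m"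
    and prior likelihood :: "real^'n \<Rightarrow> real"
    and \<mu> :: "real \<Rightarrow> real^'n" and \<Sigma> :: "real \<Rightarrow> real^'n^'n"
  assumes "sym_pos_def P" and "sym_pos_def R"
    and "\<And>x. prior x = gaussian_density xhat P x"
    and "\<And>x. likelihood x = gaussian_density (H *v x) R z"
    and "\<mu>\<^sub>p = posterior_mean xhat P H R z"
    and "invertible \<Sigma>\<^sub>p" and "matrix_inv \<Sigma>\<^sub>p = posterior_precision P H R"
    and "gaussian_fisher_rao_flow \<mu>\<^sub>p \<Sigma>\<^sub>p xhat P \<mu> \<Sigma>"
  shows "\<forall>t\<ge>0. \<forall>x.
     fisher_rao_dynamics \<mu>\<^sub>p \<Sigma>\<^sub>p \<mu> \<Sigma> x t
       = deriv time_scaling t *\<^sub>R edh_dynamics xhat P H R z x (time_scaling t) \<and>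
     deriv time_scaling t *\<^sub>R edh_dynamics xhat P H R z x (time_scaling t)
       = (1 - time_scaling t) *\<^sub>R edh_dynamics xhat P H R z x (time_scaling t)"
proof (intro allI impI)
  fix t :: real and x :: "real^'n"
  assume t: "t \<ge> 0"
  define l where "l = time_scaling t"
  have l: "l \<ge> 0" "exp (- t) = 1 - l"
    using t by (auto simp: l_def time_scaling_def)
  have deriv: "deriv time_scaling t = 1 - l"
    unfolding l(2)[symmetric] time_scaling_def
    by (intro DERIV_imp_deriv) (auto intro!: derivative_eq_intros)
  note flow = assms(8)
  define T where "T = transpose H"
  define G where "G = T ** matrix_inv R ** H"
  define V where "V = matrix_inv P"
  define N where "N = matrix_inv (\<Sigma> t)"
  \<comment> \<open>\<open>c\<close> and \<open>h\<close> are the prior and data parts of the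
    information vector. The EDH matrix will turn out to act as \<open>a\<close>, the Fisher-Rao
    matrix as \<open>(1 - l) a\<close>.\<close>
  define c where "c = V *v xhat"
  define h where "h = T *v (matrix_inv R *v z)"
  define a where "a v = (- (1/2)) *\<^sub>R (\<Sigma> t *v (G *v v))" for v
  have inv: "invertible P" "invertible R" "invertible (R + l *\<^sub>R (H ** P ** transpose H))"
    using assms(1,2) l(1) sym_pos_def_invertible innovation_covariance_invertible by auto
  have inv_t: "invertible (\<Sigma> t)"
    using flow t by (simp add: gaussian_fisher_rao_flow_def)
  have SN: "\<Sigma> t *v (N *v v) = v" for v
    using inv_t by (simp add: N_def matrix_inv_mult_vec)
  have VP: "V *v (P *v v) = v" for v
    using inv by (simp add: V_def matrix_inv_mult_vec)
  have Q: "matrix_inv \<Sigma>\<^sub>p = V + G"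
    using assms(7) by (simp add: posterior_precision_def V_def G_def T_def)
  have N: "N = V + l *\<^sub>R G"
    using fisher_rao_flow_precision[OF flow t]
    by (simp add: N_def Q l(2) V_def[symmetric] algebra_simps)
  have "(V + G) *v \<mu>\<^sub>p = c + h"
    using posterior_mean_eq[OF assms(1,2), of H xhat z] assms(5,7) Q
    by (simp add: V_def c_def h_def T_def)
  then have Q\<mu>\<^sub>p: "V *v \<mu>\<^sub>p = c + h - G *v \<mu>\<^sub>p"
    by (simp add: matrix_vector_mult_add_rdistrib algebra_simps)
  have "N *v \<mu> t = N *v \<mu>\<^sub>p + (1 - l) *\<^sub>R (V *v (xhat - \<mu>\<^sub>p))"
    using fisher_rao_flow_mean[OF flow t] by (simp add: N_def V_def l(2) algebra_simps)
  \<comment> \<open>The terms in \<open>\<mu>\<^sub>p\<close> combine to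
    \<open>l (V + G) \<mu>\<^sub>p = l (c + h)\<close>, and the prior contributes
    \<open>(1 - l) c\<close>.\<close>
  also have "\<dots> = c + l *\<^sub>R h"
    by (simp add: N Q\<mu>\<^sub>p c_def[symmetric] algebra_simps flip: scaleR_matrix_vector_assoc)
  finally have N\<mu>: "N *v \<mu> t = c + l *\<^sub>R h" .
  then have \<mu>: "\<mu> t = \<Sigma> t *v (c + l *\<^sub>R h)"
    using SN[of "\<mu> t"] by simp

  have A: "fisher_rao_A \<Sigma>\<^sub>p \<Sigma> t *v v = (1 - l) *\<^sub>R a v" for v
  proof -
    have "matrix_inv \<Sigma>\<^sub>p - matrix_inv (\<Sigma> t) = (1 - l) *\<^sub>R G"
      by (simp add: Q N flip: N_def) (simp add: algebra_simps)
    then show ?thesis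
      unfolding fisher_rao_A_def a_def
      by (simp only: scaleR_matrix_vector_assoc[symmetric] matrix_vector_mul_assoc[symmetric]
          matrix_vector_mult_scaleR scaleR_scaleR mult.commute)
  qed
  \<comment> \<open>Splitting \<open>V + G = N + (1 - l) G\<close> on \<open>\<mu> t\<close> makes
    the known value of \<open>N *v \<mu> t\<close> applicable. Since
    \<open>\<Sigma> G \<mu> = - 2 a \<mu>\<close>, subtracting the Fisher-Rao matrix term then
    leaves a single \<open>a (\<mu> t)\<close>.\<close>
  have "(\<Sigma> t ** matrix_inv \<Sigma>\<^sub>p) *v (\<mu>\<^sub>p - \<mu> t)
      = \<Sigma> t *v ((V + G) *v \<mu>\<^sub>p - (N *v \<mu> t + (1 - l) *\<^sub>R (G *v \<mu> t)))"
    by (simp add: Q N algebra_simps flip: scaleR_matrix_vector_assoc matrix_vector_mul_assoc)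
  also have "\<dots> = (1 - l) *\<^sub>R (\<Sigma> t *v h + 2 *\<^sub>R a (\<mu> t))"
    by (simp add: N\<mu> Q\<mu>\<^sub>p a_def algebra_simps)
  finally have b: "fisher_rao_b \<mu>\<^sub>p \<Sigma>\<^sub>p \<mu> \<Sigma> t = (1 - l) *\<^sub>R (\<Sigma> t *v h + a (\<mu> t))"
    by (simp add: fisher_rao_b_def A scaleR_right_diff_distrib scaleR_right_distrib scaleR_2)

  have edh_A: "edh_A P H R l *v v = a v" for v
  proof -
    let ?w = "P *v (T *v (matrix_inv (R + l *\<^sub>R (H ** P ** T)) *v (H *v v)))"
    \<comment> \<open>The gain identity at \<open>H *v v\<close>, with \<open>N = V + l G\<close> as
      the precision; applying \<open>\<Sigma> t\<close> solves for \<open>?w\<close>.\<close>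
    have "N *v ?w = G *v v"
      using kalman_gain_identity[OF inv, of "H *v v"]
      by (simp add: N V_def G_def flip: T_def matrix_vector_mul_assoc)
    then have "?w = \<Sigma> t *v (G *v v)"
      using SN[of ?w] by simp
    then show ?thesis
      unfolding edh_A_def a_def T_def[symmetric]
      by (simp only: scaleR_matrix_vector_assoc[symmetric] matrix_vector_mul_assoc[symmetric])
  qed
  have a_linear: "a (u + v) = a u + a v" "a (r *\<^sub>R v) = r *\<^sub>R a v" for u v r
    by (simp_all add: a_def algebra_simps)
  \<comment> \<open>From \<open>V = N - l G\<close>; this is the outer factor
    \<open>I + 2 l A\<close> of the EDH offset.\<close>
  have SV: "\<Sigma> t *v (V *v v) = v + (2 * l) *\<^sub>R a v" for v
    using SN[of v] by (simp add: N a_def algebra_simps flip: scaleR_matrix_vector_assoc)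
  have "edh_b xhat P H R z l
      = (a xhat + (P *v h + l *\<^sub>R a (P *v h)))
        + (2 * l) *\<^sub>R a (a xhat + (P *v h + l *\<^sub>R a (P *v h)))"
    by (simp add: edh_b_def edh_A h_def matrix_vector_mult_add_rdistrib
        flip: T_def scaleR_matrix_vector_assoc matrix_vector_mul_assoc)
  \<comment> \<open>The factor \<open>I + 2 l a\<close> commutes with \<open>a\<close>. By
    \<open>SV\<close> it sends \<open>xhat\<close> to \<open>\<Sigma> c\<close> and
    \<open>P h\<close> to \<open>\<Sigma> V P h = \<Sigma> h\<close>; the two \<open>a\<close> terms
    then merge into \<open>a (\<Sigma> (c + l h)) = a (\<mu> t)\<close>.\<close>
  also have "\<dots> = a (\<Sigma> t *v c) + (\<Sigma> t *v h + l *\<^sub>R a (\<Sigma> t *v h))"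
    using SV[of "P *v h"] by (simp add: VP c_def SV a_linear algebra_simps)
  also have "\<dots> = \<Sigma> t *v h + a (\<mu> t)"
    by (simp add: \<mu> a_linear algebra_simps)
  finally have "edh_b xhat P H R z l = \<Sigma> t *v h + a (\<mu> t)" .
  then have "fisher_rao_dynamics \<mu>\<^sub>p \<Sigma>\<^sub>p \<mu> \<Sigma> x t = (1 - l) *\<^sub>R edh_dynamics xhat P H R z x l"
    by (simp add: fisher_rao_dynamics_def edh_dynamics_def A b edh_A algebra_simps)
  then show "fisher_rao_dynamics \<mu>\<^sub>p \<Sigma>\<^sub>p \<mu> \<Sigma> x t
       = deriv time_scaling t *\<^sub>R edh_dynamics xhat P H R z x (time_scaling t) \<and>
     deriv time_scaling t *\<^sub>R edh_dynamics xhat P H R z x (time_scaling t)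
       = (1 - time_scaling t) *\<^sub>R edh_dynamics xhat P H R z x (time_scaling t)"
    by (simp add: deriv flip: l_def)
qed

end
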